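(* Let $D$ be a finite set of positive integers. Let $S \subseteq \mathbb{N}=\{0,1,2,\dots\}$ be a $D$-avoiding set which is germ-maximal among $D$-avoiding sets, i.e. there is no $D$-avoiding set $S' \subseteq \mathbb{N}$ with $S \prec S'$. Then $S$ is rational, i.e. eventually periodic: there exist $N \in \mathbb{N}$ and $d \geq 1$ such that for all $n \geq N$, $n \in S$ if and only if $n+d \in S$.
   Context: A set $S \subseteq \mathbb{N}$ is called $D$-avoiding if there are no two elements of $S$ whose difference lies in $D$. For $S \subseteq \mathbb{N}$, its generating function is $S_q := \sum_{n \in S} q^n$, which converges for $q \in (-1,1)$. For $S, S' \subseteq \mathbb{N}$, write $S \preceq S'$ (germ-ordering at $1^-$) iff there exists $\epsilon > 0$ such that $S_q \leq S'_q$ for all $q \in (1-\epsilon, 1)$; write $S \prec S'$ iff $S \preceq S'$ and $S \neq S'$. A set $S\subseteq\mathbb{N}$ is called rational iff it is eventually periodic (equivalently, $S_q$ is a rational function of $q$). *)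

theory Defs
  imports "HOL-Analysis.Infinite_Sum"
begin

definition avoiding :: "nat set \<Rightarrow> nat set \<Rightarrow> bool" where
  "avoiding D S \<longleftrightarrow> \<not> (\<exists>a\<in>S. \<exists>b\<in>S. a < b \<and> b - a \<in> D)"

definition gen_fun :: "nat set \<Rightarrow> real \<Rightarrow> real" where
  "gen_fun S q = (\<Sum>\<^sub>\<infinity>n\<in>S. q ^ n)"

text \<open>On \<open>(-1, 1)\<close> the defining sum genuinely converges, so the default value \<open>0\<close> of a
  divergent \<^const>\<open>infsum\<close> plays no role there.\<close>

lemma gen_fun_summable:
  fixes q :: real
  assumes "q \<in> {-1<..<1}"
  shows "(\<lambda>n. q ^ n) summable_on S"
proof -
  have "summable (\<lambda>n. norm (q ^ n))"
    using assms by (simp add: power_abs summable_geometric abs_less_iff)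
  then have "(\<lambda>n. q ^ n) summable_on UNIV"
    by (rule norm_summable_imp_summable_on)
  then show ?thesis
    by (rule summable_on_subset_banach) simp
qed

text \<open>For \<open>\<epsilon> > 2\<close> the interval leaves the domain of convergence; this is harmless, since any
  witness \<open>\<epsilon>\<close> may be replaced by a smaller one.\<close>

definition germ_le :: "nat set \<Rightarrow> nat set \<Rightarrow> bool" where
  "germ_le S S' \<longleftrightarrow> (\<exists>\<epsilon>>0. \<forall>q\<in>{1 - \<epsilon><..<1}. gen_fun S q \<le> gen_fun S' q)"

definition germ_less :: "nat set \<Rightarrow> nat set \<Rightarrow> bool" where
  "germ_less S S' \<longleftrightarrow> germ_le S S' \<and> S \<noteq> S'"

definition rational_set :: "nat set \<Rightarrow> bool" where
  "rational_set S \<longleftrightarrow> (\<exists>N. \<exists>d\<ge>1. \<forall>n\<ge>N. n \<in> S \<longleftrightarrow> n + d \<in> S)"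

end

theory Submission
  imports Defs "HOL-Computational_Algebra.Polynomial"
begin

text \<open>Fix \<open>m > max D\<close>. A \<open>D\<close>-avoiding set is an infinite walk on the finitely many traces that
  \<open>D\<close>-avoiding sets leave on \<open>{0, \<dots>, m - 1}\<close>, and its generating function at \<open>q\<close> is the discounted
  reward of that walk, so this is a deterministic Markov decision process. For each \<open>q\<close> the best
  reward is reached by a stationary policy. The finitely many stationary policies yield eventually
  periodic sets, whose generating functions are rational and hence pairwise comparable near \<open>1\<close>.
  So one of them, \<open>T\<close>, is optimal for all \<open>q\<close> near \<open>1\<close> (Blackwell optimality): every \<open>D\<close>-avoiding
  \<open>S\<close> satisfies \<open>S \<preceq> T\<close>, and a germ-maximal \<open>S\<close> is equal to \<open>T\<close>.\<close>

section \<open>Generating functions and shifts\<close>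

definition shift :: "nat set \<Rightarrow> nat set" where
  "shift S = {n. Suc n \<in> S}"

lemma funpow_shift: "(shift ^^ k) S = {n. n + k \<in> S}"
  by (induction k) (auto simp: shift_def)

lemma avoiding_shift:
  assumes "avoiding D S"
  shows "avoiding D (shift S)"
  unfolding avoiding_def shift_def
proof clarsimp
  fix a b assume "Suc a \<in> S" "Suc b \<in> S" "a < b" "b - a \<in> D"
  moreover from this have "Suc a < Suc b" "Suc b - Suc a \<in> D" by auto
  ultimately show False using assms unfolding avoiding_def by blast
qed

lemma gen_fun_shift:
  assumes "q \<in> {-1<..<1}"
  shows "gen_fun S q = of_bool (0 \<in> S) + q * gen_fun (shift S) q"
proof -
  have pos: "gen_fun (S - {0}) q = q * gen_fun (shift S) q"
  proof -
    have "S - {0} = Suc ` shift S"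
      by (auto simp: shift_def image_iff) (metis not0_implies_Suc)
    then have "gen_fun (S - {0}) q = infsum ((\<lambda>n. q ^ n) \<circ> Suc) (shift S)"
      unfolding gen_fun_def by (simp add: infsum_reindex)
    also have "\<dots> = q * gen_fun (shift S) q"
      unfolding gen_fun_def by (simp add: o_def infsum_cmult_right')
    finally show ?thesis .
  qed
  show ?thesis
  proof (cases "0 \<in> S")
    case True
    then have "gen_fun S q = gen_fun ({0} \<union> (S - {0})) q"
      by (simp add: insert_absorb)
    also have "\<dots> = gen_fun {0} q + gen_fun (S - {0}) q"
      unfolding gen_fun_def
      by (rule infsum_Un_disjoint) (use gen_fun_summable[OF assms] in auto)
    finally show ?thesis using pos True by (simp add: gen_fun_def)
  next
    case False
    then show ?thesis using pos by simp
  qed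
qed

text \<open>For positive \<open>q\<close> all terms are nonnegative. This bound, uniform in
  \<open>S\<close>, keeps the supremum in the value function \<open>V\<close> of the policy argument
  finite.\<close>

lemma gen_fun_le_UNIV:
  assumes "q \<in> {0<..<1}"
  shows "gen_fun S q \<le> gen_fun UNIV q"
  unfolding gen_fun_def
  by (rule infsum_mono_neutral) (use assms gen_fun_summable in auto)

text \<open>Iterates \<open>gen_fun_shift\<close>. The initial segment is packaged as a polynomial,
  the form needed for the sign argument at 1.\<close>

lemma gen_fun_funpow_shift:
  assumes "q \<in> {-1<..<1}"
  shows "gen_fun S q =
    poly (\<Sum>n<k. monom (of_bool (n \<in> S)) n) q + q ^ k * gen_fun ((shift ^^ k) S) q"
proof (induction k)
  case 0
  then show ?case by simp
next
  case (Suc k)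
  have "gen_fun ((shift ^^ k) S) q =
      of_bool (k \<in> S) + q * gen_fun ((shift ^^ Suc k) S) q"
    using gen_fun_shift[OF assms, of "(shift ^^ k) S"] by (simp add: funpow_shift)
  then show ?case
    by (subst Suc) (simp add: poly_monom algebra_simps del: funpow.simps)
qed

section \<open>Comparability of rational sets\<close>

text \<open>The tail \<open>P\<close> from \<open>N\<close> on is invariant under \<open>d\<close>
  shifts, so \<open>gen_fun P q = poly v q + q ^ d * gen_fun P q\<close>. Clearing the denominator
  \<open>1 - q ^ d\<close> leaves a polynomial.\<close>

lemma rational_set_gen_fun:
  assumes "rational_set S"
  obtains p d where "d \<ge> 1" "\<And>q. q \<in> {0<..<1} \<Longrightarrow> gen_fun S q * (1 - q ^ d) = poly p q"
proof -
  obtain N d where d: "d \<ge> 1" and per: "\<And>n. n \<ge> N \<Longrightarrow> n \<in> S \<longleftrightarrow> n + d \<in> S"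
    using assms unfolding rational_set_def by blast
  define P where "P = (shift ^^ N) S"
  have "(shift ^^ d) P = P"
  proof (rule set_eqI)
    fix n
    show "n \<in> (shift ^^ d) P \<longleftrightarrow> n \<in> P"
      using per[of "n + N"] by (simp add: P_def funpow_shift add.commute add.left_commute)
  qed
  define u where "u = (\<Sum>n<N. monom (of_bool (n \<in> S)) n :: real poly)"
  define v where "v = (\<Sum>n<d. monom (of_bool (n \<in> P)) n :: real poly)"
  show ?thesis
  proof (rule that[OF d, of "u * (1 - monom 1 d) + monom 1 N * v"])
    fix q :: real assume "q \<in> {0<..<1}"
    then have q: "q \<in> {-1<..<1}" by simp
    have S: "gen_fun S q = poly u q + q ^ N * gen_fun P q"
      using gen_fun_funpow_shift[OF q, of S N] by (simp add: u_def P_def)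
    have "gen_fun P q * (1 - q ^ d) = poly v q"
      using gen_fun_funpow_shift[OF q, of P d] \<open>(shift ^^ d) P = P\<close>
      by (simp add: v_def algebra_simps)
    then show "gen_fun S q * (1 - q ^ d) = poly (u * (1 - monom 1 d) + monom 1 N * v) q"
      unfolding S by (simp add: poly_monom distrib_right mult.assoc)
  qed
qed

text \<open>Split off the full power of the root \<open>a\<close>: the cofactor keeps its sign near
  \<open>a\<close> by continuity, and the sign of \<open>(x - a) ^ k\<close> for
  \<open>x < a\<close> depends only on the parity of \<open>k\<close>.\<close>

lemma poly_sign_at_left:
  fixes p :: "real poly"
  shows "(\<forall>\<^sub>F x in at_left a. poly p x \<le> 0) \<or> (\<forall>\<^sub>F x in at_left a. poly p x \<ge> 0)"
proof (cases "p = 0")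
  case True
  then show ?thesis by simp
next
  case False
  then obtain r where p: "p = [:-a, 1:] ^ order a p * r" and "\<not> [:-a, 1:] dvd r"
    using order_decomp by blast
  then have "poly r a \<noteq> 0" by (simp add: poly_eq_0_iff_dvd)
  define k where "k = order a p"
  have px: "poly p x = (x - a) ^ k * poly r x" for x
    by (subst p) (simp add: k_def)
  have lim: "(poly r \<longlongrightarrow> poly r a) (at_left a)"
    by (rule tendsto_within_subset[OF poly_isCont[unfolded isCont_def]]) simp
  have r: "(\<forall>\<^sub>F x in at_left a. poly r x \<le> 0) \<or> (\<forall>\<^sub>F x in at_left a. poly r x \<ge> 0)"
  proof (cases "poly r a < 0")
    case True
    then have "\<forall>\<^sub>F x in at_left a. poly r x \<le> 0"
      using order_tendstoD(2)[OF lim, of 0] by (auto elim: eventually_mono)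
    then show ?thesis ..
  next
    case False
    then have "\<forall>\<^sub>F x in at_left a. poly r x \<ge> 0"
      using order_tendstoD(1)[OF lim, of 0] \<open>poly r a \<noteq> 0\<close> by (auto elim: eventually_mono)
    then show ?thesis ..
  qed
  have left: "\<forall>\<^sub>F x in at_left a. x < a"
    by (simp add: eventually_at_filter)
  show ?thesis
  proof (cases "even k")
    case True
    then have "(x - a) ^ k \<ge> 0" for x by (simp add: zero_le_even_power)
    then show ?thesis using r unfolding px
      by (metis (mono_tags, lifting) eventually_mono mult_nonneg_nonneg mult_nonneg_nonpos)
  next
    case False
    then have neg: "(x - a) ^ k \<le> 0" if "x < a" for x
      using that by (simp add: power_le_zero_eq odd_pos)
    from r show ?thesis
    proof
      assume "\<forall>\<^sub>F x in at_left a. poly r x \<le> 0"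
      then have "\<forall>\<^sub>F x in at_left a. poly p x \<ge> 0"
        using left by eventually_elim (auto simp: px neg mult_nonpos_nonpos)
      then show ?thesis ..
    next
      assume "\<forall>\<^sub>F x in at_left a. poly r x \<ge> 0"
      then have "\<forall>\<^sub>F x in at_left a. poly p x \<le> 0"
        using left by eventually_elim (auto simp: px neg mult_nonpos_nonneg)
      then show ?thesis ..
    qed
  qed
qed

lemma germ_le_iff_eventually:
  "germ_le S T \<longleftrightarrow> (\<forall>\<^sub>F q in at_left 1. gen_fun S q \<le> gen_fun T q)"
proof
  assume "germ_le S T"
  then obtain e where "e > 0" "\<forall>q\<in>{1 - e<..<1}. gen_fun S q \<le> gen_fun T q"
    unfolding germ_le_def by blast
  then show "\<forall>\<^sub>F q in at_left 1. gen_fun S q \<le> gen_fun T q"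
    unfolding eventually_at_left_field by (intro exI[of _ "1 - e"]) auto
next
  assume "\<forall>\<^sub>F q in at_left 1. gen_fun S q \<le> gen_fun T q"
  then obtain b where "b < 1" "\<forall>q>b. q < 1 \<longrightarrow> gen_fun S q \<le> gen_fun T q"
    unfolding eventually_at_left_field by blast
  then show "germ_le S T"
    unfolding germ_le_def by (intro exI[of _ "1 - b"]) auto
qed

lemma germ_le_refl: "germ_le S S"
  by (simp add: germ_le_iff_eventually)

lemma germ_le_trans:
  assumes "germ_le S T" "germ_le T U"
  shows "germ_le S U"
  using assms unfolding germ_le_iff_eventually by eventually_elim linarith

lemma eventually_at_left_1: "\<forall>\<^sub>F q in at_left (1 :: real). q \<in> {0<..<1}"
  unfolding eventually_at_left_field by (intro exI[of _ 0]) auto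

text \<open>Multiplied by the positive factor \<open>(1 - q ^ d) * (1 - q ^ e)\<close>, the
  difference of the two generating functions is a polynomial, which has a constant weak sign just
  left of 1.\<close>

lemma germ_le_total:
  assumes "rational_set S" "rational_set T"
  shows "germ_le S T \<or> germ_le T S"
proof -
  obtain p d where d: "d \<ge> 1"
    and p: "\<And>q. q \<in> {0<..<1} \<Longrightarrow> gen_fun S q * (1 - q ^ d) = poly p q"
    using rational_set_gen_fun[OF assms(1)] by metis
  obtain r e where e: "e \<ge> 1"
    and r: "\<And>q. q \<in> {0<..<1} \<Longrightarrow> gen_fun T q * (1 - q ^ e) = poly r q"
    using rational_set_gen_fun[OF assms(2)] by metis
  define s where "s = p * (1 - monom 1 e) - r * (1 - monom 1 d)"
  have s: "poly s q = (gen_fun S q - gen_fun T q) * ((1 - q ^ d) * (1 - q ^ e))"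
    and pos: "(1 - q ^ d) * (1 - q ^ e) > 0" if q: "q \<in> {0<..<1}" for q
  proof -
    show "poly s q = (gen_fun S q - gen_fun T q) * ((1 - q ^ d) * (1 - q ^ e))"
      by (simp add: s_def poly_monom flip: p[OF q] r[OF q]) (simp add: algebra_simps)
    have "q ^ d < 1" "q ^ e < 1"
      using q d e by (auto intro!: power_less_one_iff[THEN iffD2])
    then show "(1 - q ^ d) * (1 - q ^ e) > 0" by simp
  qed
  from poly_sign_at_left[of s 1] show ?thesis
  proof
    assume "\<forall>\<^sub>F q in at_left 1. poly s q \<le> 0"
    with eventually_at_left_1 have "germ_le S T"
      unfolding germ_le_iff_eventually
      by eventually_elim (metis s pos mult_le_0_iff diff_le_0_iff_le not_le)
    then show ?thesis ..
  next
    assume "\<forall>\<^sub>F q in at_left 1. poly s q \<ge> 0"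
    with eventually_at_left_1 have "germ_le T S"
      unfolding germ_le_iff_eventually
      by eventually_elim (metis s pos zero_le_mult_iff diff_ge_0_iff_ge not_le)
    then show ?thesis ..
  qed
qed

lemma finite_rational_sets_greatest:
  assumes "finite F" "F \<noteq> {}" "\<And>T. T \<in> F \<Longrightarrow> rational_set T"
  shows "\<exists>T\<in>F. \<forall>T'\<in>F. germ_le T' T"
  using assms
proof (induction F rule: finite_ne_induct)
  case (singleton T)
  then show ?case by (simp add: germ_le_refl)
next
  case (insert U F)
  then obtain T where T: "T \<in> F" "\<forall>T'\<in>F. germ_le T' T" by auto
  have "germ_le U T \<or> germ_le T U"
    using insert.prems T by (intro germ_le_total) auto
  then show ?case
  proof
    assume "germ_le U T"
    then show ?thesis using T by auto
  next
    assume "germ_le T U"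
    then have "\<forall>T'\<in>insert U F. germ_le T' U"
      using T germ_le_trans germ_le_refl by blast
    then show ?thesis by blast
  qed
qed

section \<open>Stationary policies\<close>

text \<open>The states of the decision process. Each comes from a whole avoiding set, whose shift
  then provides a successor state.\<close>

definition traces :: "nat set \<Rightarrow> nat \<Rightarrow> nat set set" where
  "traces D m = (\<lambda>R. R \<inter> {..<m}) ` Collect (avoiding D)"

definition successors :: "nat set \<Rightarrow> nat \<Rightarrow> nat set \<Rightarrow> nat set set" where
  "successors D m w = (\<lambda>R. shift R \<inter> {..<m}) ` {R. avoiding D R \<and> R \<inter> {..<m} = w}"

text \<open>Position 0 of the current window is the bit emitted at each time; the orbit of
  \<open>w\<close> under \<pi> thus spells out a set.\<close>

definition itinerary :: "(nat set \<Rightarrow> nat set) \<Rightarrow> nat set \<Rightarrow> nat set" where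
  "itinerary \<pi> w = {n. 0 \<in> (\<pi> ^^ n) w}"

lemma finite_traces: "finite (traces D m)"
  by (rule finite_subset[of _ "Pow {..<m}"]) (auto simp: traces_def)

lemma successors_subset_traces: "successors D m w \<subseteq> traces D m"
  using avoiding_shift unfolding successors_def traces_def by blast

lemma successors_nonempty: "w \<in> traces D m \<Longrightarrow> successors D m w \<noteq> {}"
  unfolding successors_def traces_def by blast

text \<open>Both windows are cut from one set \<open>R\<close> and its shift, so they agree on their
  overlap. The position \<open>m - 1\<close> of \<open>w'\<close> lies outside this overlap.\<close>

lemma mem_successor_iff:
  assumes "w' \<in> successors D m w" "Suc j < m"
  shows "j \<in> w' \<longleftrightarrow> Suc j \<in> w"
  using assms by (auto simp: successors_def shift_def)

lemma shift_itinerary: "shift (itinerary \<pi> w) = itinerary \<pi> (\<pi> w)"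
  by (simp add: shift_def itinerary_def funpow_swap1)

lemma funpow_closed:
  assumes "\<pi> \<in> A \<rightarrow> A" "w \<in> A"
  shows "(\<pi> ^^ n) w \<in> A"
  using assms by (induction n) auto

lemma rational_set_itinerary:
  assumes "finite A" "\<pi> \<in> A \<rightarrow> A" "w \<in> A"
  shows "rational_set (itinerary \<pi> w)"
proof -
  \<comment> \<open>Pigeonhole: the orbit stays in a finite set, so it revisits a state, and from
    then on it repeats.\<close>
  have "\<not> inj (\<lambda>n. (\<pi> ^^ n) w)"
    using assms funpow_closed[OF assms(2,3)]
    by (metis finite_imageD finite_subset image_subsetI infinite_UNIV_nat)
  then obtain i j where "i < j" and eq: "(\<pi> ^^ i) w = (\<pi> ^^ j) w"
    by (metis (mono_tags, lifting) injI linorder_neqE_nat)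
  have "(\<pi> ^^ (n + (j - i))) w = (\<pi> ^^ n) w" if "n \<ge> i" for n
  proof -
    have "(\<pi> ^^ (n + (j - i))) w = (\<pi> ^^ (n - i)) ((\<pi> ^^ j) w)"
      using \<open>i < j\<close> that funpow_add[of "n - i" j \<pi>] by simp
    also have "\<dots> = (\<pi> ^^ n) w"
      using that funpow_add[of "n - i" i \<pi>] eq by simp
    finally show ?thesis .
  qed
  then show ?thesis
    using \<open>i < j\<close> unfolding rational_set_def itinerary_def
    by (intro exI[of _ i] exI[of _ "j - i"]) auto
qed

text \<open>Every forbidden difference is below \<open>m\<close>, so a violating pair would show up
  inside a single window, and each window is the trace of an avoiding set.\<close>

lemma avoiding_itinerary:
  assumes D: "\<forall>d\<in>D. d < m"
    and \<pi>: "\<And>v. v \<in> traces D m \<Longrightarrow> \<pi> v \<in> successors D m v"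
    and w: "w \<in> traces D m"
  shows "avoiding D (itinerary \<pi> w)"
proof -
  have "\<pi> \<in> traces D m \<rightarrow> traces D m"
    using \<pi> successors_subset_traces by blast
  then have tr: "(\<pi> ^^ n) w \<in> traces D m" for n
    using funpow_closed[of \<pi> _ w] w by simp
  \<comment> \<open>Each move slides the window by one place, so the bit at position
    \<open>j\<close> reaches position 0, and is emitted, \<open>j\<close> moves later.\<close>
  have window: "j \<in> (\<pi> ^^ n) w \<longleftrightarrow> n + j \<in> itinerary \<pi> w" if "j < m" for j n
    using that
  proof (induction j arbitrary: n)
    case 0
    then show ?case by (simp add: itinerary_def)
  next
    case (Suc j)
    have "Suc j \<in> (\<pi> ^^ n) w \<longleftrightarrow> j \<in> (\<pi> ^^ Suc n) w"
      using mem_successor_iff[OF \<pi>[OF tr[of n]] Suc.prems] by simp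
    also have "\<dots> \<longleftrightarrow> Suc n + j \<in> itinerary \<pi> w"
      using Suc by (simp del: funpow.simps)
    finally show ?case by simp
  qed
  show ?thesis
    unfolding avoiding_def
  proof clarify
    fix a b assume a: "a \<in> itinerary \<pi> w" and b: "b \<in> itinerary \<pi> w"
      and "a < b" and d: "b - a \<in> D"
    have "0 \<in> (\<pi> ^^ a) w" using a by (simp add: itinerary_def)
    moreover have "b - a \<in> (\<pi> ^^ a) w"
      using window[of "b - a" a] b d D \<open>a < b\<close> by simp
    moreover obtain R where "avoiding D R" "(\<pi> ^^ a) w = R \<inter> {..<m}"
      using tr[of a] by (auto simp: traces_def)
    ultimately show False
      using d \<open>a < b\<close> unfolding avoiding_def by fastforce
  qed
qed

text \<open>The policy \<open>\<pi>\<close> is greedy for the value function \<open>V\<close>. The gap between \<open>V\<close> and the reward of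
  \<open>\<pi>\<close> at a trace is at most \<open>q < 1\<close> times the gap at its successor, so the maximal gap is at most
  \<open>0\<close>.\<close>

lemma optimal_policy_exists:
  assumes q: "q \<in> {0<..<1}" and "m > 0"
  obtains \<pi> where "\<And>w. w \<in> traces D m \<Longrightarrow> \<pi> w \<in> successors D m w"
    and "\<And>S. avoiding D S \<Longrightarrow> gen_fun S q \<le> gen_fun (itinerary \<pi> (S \<inter> {..<m})) q"
proof -
  have q1: "q \<in> {-1<..<1}" using q by simp
  \<comment> \<open>The optimal value of a state: the best reward over all avoiding sets with this
    trace, not only over those produced by policies.\<close>
  define V where "V w = (SUP R\<in>{R. avoiding D R \<and> R \<inter> {..<m} = w}. gen_fun R q)" for w
  have V: "gen_fun R q \<le> V (R \<inter> {..<m})" if "avoiding D R" for R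
    unfolding V_def
    by (rule cSUP_upper) (use that gen_fun_le_UNIV[OF q] in \<open>auto intro!: bdd_aboveI2\<close>)
  have "\<exists>w'\<in>successors D m w. \<forall>v\<in>successors D m w. V v \<le> V w'" if w: "w \<in> traces D m" for w
  proof -
    have fin: "finite (V ` successors D m w)"
      using finite_subset[OF successors_subset_traces finite_traces] by blast
    have "Max (V ` successors D m w) \<in> V ` successors D m w"
      using fin successors_nonempty[OF w] by (intro Max_in) auto
    then show ?thesis using Max_ge[OF fin] by (metis imageE imageI)
  qed
  then obtain \<pi> where \<pi>: "\<And>w. w \<in> traces D m \<Longrightarrow> \<pi> w \<in> successors D m w"
    and \<pi>_max: "\<And>w v. w \<in> traces D m \<Longrightarrow> v \<in> successors D m w \<Longrightarrow> V v \<le> V (\<pi> w)"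
    by metis
  \<comment> \<open>One half of the Bellman equation: after its first bit, any competitor
    \<open>R\<close> continues as \<open>shift R\<close>, whose trace is a successor of
    \<open>w\<close> and has value at most \<open>V (\<pi> w)\<close>.\<close>
  have greedy: "V w \<le> of_bool (0 \<in> itinerary \<pi> w) + q * V (\<pi> w)" if w: "w \<in> traces D m" for w
    unfolding V_def[of w]
  proof (rule cSUP_least)
    show "{R. avoiding D R \<and> R \<inter> {..<m} = w} \<noteq> {}"
      using w by (auto simp: traces_def)
  next
    fix R assume R: "R \<in> {R. avoiding D R \<and> R \<inter> {..<m} = w}"
    show "gen_fun R q \<le> of_bool (0 \<in> itinerary \<pi> w) + q * V (\<pi> w)"
    proof -
      have "avoiding D R" "shift R \<inter> {..<m} \<in> successors D m w"
        using R by (auto simp: successors_def)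
      then have "gen_fun (shift R) q \<le> V (\<pi> w)"
        using V[OF avoiding_shift] \<pi>_max[OF w] by (metis order.trans)
      \<comment> \<open>As \<open>m > 0\<close>, the window \<open>w\<close> contains position 0 and
        fixes the first bit of every competitor.\<close>
      moreover have "of_bool (0 \<in> R) \<le> (of_bool (0 \<in> itinerary \<pi> w) :: real)"
        using R \<open>m > 0\<close> by (auto simp: itinerary_def)
      ultimately show ?thesis
        using gen_fun_shift[OF q1, of R] q by (simp add: add_mono mult_left_mono)
    qed
  qed
  define gap where "gap w = V w - gen_fun (itinerary \<pi> w) q" for w
  have step: "gap w \<le> q * gap (\<pi> w)" if "w \<in> traces D m" for w
    using greedy[OF that] gen_fun_shift[OF q1, of "itinerary \<pi> w"]
    by (simp add: gap_def shift_itinerary right_diff_distrib)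
  have gap: "gap w \<le> 0" if w: "w \<in> traces D m" for w
  proof -
    define M where "M = Max (gap ` traces D m)"
    have le_M: "gap v \<le> M" if "v \<in> traces D m" for v
      using that finite_traces by (simp add: M_def)
    have "M \<in> gap ` traces D m"
      unfolding M_def using w finite_traces by (intro Max_in) auto
    then obtain v where v: "v \<in> traces D m" "M = gap v" by blast
    have "\<pi> v \<in> traces D m" using \<pi>[OF v(1)] successors_subset_traces by blast
    then have "M \<le> q * M"
      using step[OF v(1)] le_M[of "\<pi> v"] q v(2)
      by (metis greaterThanLessThan_iff mult_left_mono order.trans less_imp_le)
    then have "(1 - q) * M \<le> 0" by (simp add: algebra_simps)
    then have "M \<le> 0" using q by (auto simp: mult_le_0_iff)
    then show ?thesis using le_M[OF w] by linarith
  qed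
  show ?thesis
  proof (rule that[OF \<pi>])
    fix S assume S: "avoiding D S"
    then have "S \<inter> {..<m} \<in> traces D m" by (auto simp: traces_def)
    then show "gen_fun S q \<le> gen_fun (itinerary \<pi> (S \<inter> {..<m})) q"
      using V[OF S] gap unfolding gap_def by force
  qed
qed

section \<open>One stationary policy for all \<open>q\<close> near 1\<close>

theorem theorem4:
  fixes D S :: "nat set"
  assumes "finite D"
    and "\<forall>d\<in>D. d > 0"
    and "avoiding D S"
    and "\<not> (\<exists>S'. avoiding D S' \<and> germ_less S S')"
  shows "rational_set S"
proof -
  obtain k where "\<forall>d\<in>D. d \<le> k"
    using assms(1) finite_nat_set_iff_bounded_le by auto
  \<comment> \<open>The successor of the bound makes the inequality strict and keeps
    \<open>m\<close> positive even for empty \<open>D\<close>.\<close>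
  then obtain m where m: "\<forall>d\<in>D. d < m" and "m > 0"
    by (intro that[of "Suc k"]) auto
  define w where "w = S \<inter> {..<m}"
  have w: "w \<in> traces D m" using assms(3) by (auto simp: w_def traces_def)
  \<comment> \<open>Extensional functions make the set of policies finite: values off the traces are
    pinned to \<open>undefined\<close>.\<close>
  define Pol where "Pol = (\<Pi>\<^sub>E v\<in>traces D m. successors D m v)"
  define F where "F = (\<lambda>\<pi>. itinerary \<pi> w) ` Pol"
  have Pol: "\<pi> v \<in> successors D m v" if "\<pi> \<in> Pol" "v \<in> traces D m" for \<pi> v
    using that by (auto simp: Pol_def)
  have "finite Pol"
    unfolding Pol_def
    by (intro finite_PiE finite_traces finite_subset[OF successors_subset_traces finite_traces])
  then have "finite F" by (simp add: F_def)
  have closed: "\<pi> \<in> traces D m \<rightarrow> traces D m" if "\<pi> \<in> Pol" for \<pi>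
    using Pol[OF that] successors_subset_traces by blast
  have rational: "rational_set T" if "T \<in> F" for T
    using that rational_set_itinerary[OF finite_traces closed w] by (auto simp: F_def)
  have avoids: "avoiding D T" if "T \<in> F" for T
    using that avoiding_itinerary[OF m Pol w] by (auto simp: F_def)
  \<comment> \<open>Here \<open>T\<close> may still depend on \<open>q\<close>.\<close>
  have dominated: "\<exists>T\<in>F. gen_fun S q \<le> gen_fun T q" if q: "q \<in> {0<..<1}" for q
  proof -
    obtain \<pi> where \<pi>: "\<And>v. v \<in> traces D m \<Longrightarrow> \<pi> v \<in> successors D m v"
      and opt: "gen_fun S q \<le> gen_fun (itinerary \<pi> w) q"
      using optimal_policy_exists[OF q \<open>m > 0\<close>, of D] assms(3) unfolding w_def by metis
    \<comment> \<open>Restricting \<pi> puts it into \<open>Pol\<close> without changing its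
      itinerary from \<open>w\<close>, since the orbit never leaves the traces.\<close>
    define \<rho> where "\<rho> = restrict \<pi> (traces D m)"
    have "\<rho> \<in> Pol" using \<pi> by (auto simp: \<rho>_def Pol_def)
    have "(\<rho> ^^ n) w = (\<pi> ^^ n) w" for n
    proof (induction n)
      case (Suc n)
      have "(\<rho> ^^ n) w \<in> traces D m"
        by (rule funpow_closed[OF closed[OF \<open>\<rho> \<in> Pol\<close>] w])
      then have "\<rho> ((\<rho> ^^ n) w) = \<pi> ((\<rho> ^^ n) w)"
        unfolding \<rho>_def by (rule restrict_apply')
      then show ?case using Suc by simp
    qed simp
    then have "itinerary \<rho> w = itinerary \<pi> w" by (simp add: itinerary_def)
    then show ?thesis using opt \<open>\<rho> \<in> Pol\<close> unfolding F_def by (metis imageI)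
  qed
  have "F \<noteq> {}" using dominated[of "1 / 2"] by auto
  then obtain T where T: "T \<in> F" and best: "\<forall>T'\<in>F. germ_le T' T"
    using finite_rational_sets_greatest[OF \<open>finite F\<close>] rational by blast
  \<comment> \<open>Finiteness of \<open>F\<close> gives one left neighbourhood of 1 for all
    comparisons. There the \<open>q\<close>-dependent dominating set can be replaced by the fixed
    \<open>T\<close>.\<close>
  have "\<forall>\<^sub>F q in at_left 1. \<forall>T'\<in>F. gen_fun T' q \<le> gen_fun T q"
    using best \<open>finite F\<close> by (simp add: eventually_ball_finite germ_le_iff_eventually)
  with eventually_at_left_1 have "germ_le S T"
    unfolding germ_le_iff_eventually
  proof eventually_elim
    case (elim q)
    then show ?case using dominated[of q] by force
  qed
  then have "S = T"
    using assms(4) avoids[OF T] unfolding germ_less_def by blast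
  then show ?thesis using rational[OF T] by simp
qed

end
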